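(* Let $n \ge 1$ and let $p \ge q \ge 1$ be integers. Then $P_p^q - P_q^p \in S_n$. If moreover $p \le n$, then $E_q^p - E_p^q \in S_n$. (Here superscripts denote powers.)
   Context: In $\mathbb{R}[x_1,\dots,x_n]$, the normalized power sums are $P_k = \frac{1}{n}\sum_{i=1}^n x_i^k$ for integers $k \ge 0$ (so $P_0 = 1$), and the normalized elementary symmetric polynomials are $E_k = \binom{n}{k}^{-1}\sum_{1 \le i_1<\dots<i_k \le n} x_{i_1}\cdots x_{i_k}$ for integers $0 \le k \le n$ (so $E_0 = 1$). $S_n \subseteq \mathbb{R}[x_1,\dots,x_n]$ denotes the set of all polynomials of the form $\sum_{\varepsilon \in \{0,1\}^n} r_{\varepsilon} \prod_{j=1}^n x_j^{\varepsilon_j}$, where each $r_{\varepsilon}$ is a (finite) sum of squares of polynomials in $\mathbb{R}[x_1,\dots,x_n]$. Equivalently, $S_n$ is the semiring generated by the variables $x_1,\dots,x_n$ and the squares of all polynomials in $\mathbb{R}[x_1,\dots,x_n]$. *)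

theory Defs
  imports Complex_Main "HOL-Library.Poly_Mapping" "HOL-Library.FuncSet"
begin

text \<open>
  A monomial is a finitely supported exponent vector \<^typ>\<open>nat \<Rightarrow>\<^sub>0 nat\<close>, and a polynomial is a
  finitely supported map from monomials to real coefficients; multiplication on
  \<^type>\<open>poly_mapping\<close> is convolution. The polynomials in the variables of index \<open>1, \<dots>, n\<close> are cut
  out of this ring (which has infinitely many variables) by \<open>polys n\<close>.
\<close>

type_synonym mpoly = "(nat \<Rightarrow>\<^sub>0 nat) \<Rightarrow>\<^sub>0 real"

definition Var :: "nat \<Rightarrow> mpoly" where
  "Var i = Poly_Mapping.single (Poly_Mapping.single i 1) 1"

definition Const :: "real \<Rightarrow> mpoly" where
  "Const c = Poly_Mapping.single 0 c"

definition polys :: "nat \<Rightarrow> mpoly set" where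
  "polys n = {f. \<forall>m \<in> Poly_Mapping.keys f. Poly_Mapping.keys m \<subseteq> {1..n}}"

definition power_mean_poly :: "nat \<Rightarrow> nat \<Rightarrow> mpoly" where
  "power_mean_poly n k = Const (1 / real n) * (\<Sum>i = 1..n. Var i ^ k)"

definition elem_mean_poly :: "nat \<Rightarrow> nat \<Rightarrow> mpoly" where
  "elem_mean_poly n k =
     Const (1 / real (n choose k)) * (\<Sum>A | A \<subseteq> {1..n} \<and> card A = k. \<Prod>i\<in>A. Var i)"

definition sums_of_squares :: "nat \<Rightarrow> mpoly set" where
  "sums_of_squares n = {\<Sum>i<m. (g i)\<^sup>2 | (m :: nat) g. \<forall>i<m. g i \<in> polys n}"

definition S_cone :: "nat \<Rightarrow> mpoly set" where
  "S_cone n =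
     {\<Sum>\<epsilon> \<in> {1..n} \<rightarrow>\<^sub>E {0, 1 :: nat}. r \<epsilon> * (\<Prod>j = 1..n. Var j ^ \<epsilon> j)
       | r. \<forall>\<epsilon> \<in> {1..n} \<rightarrow>\<^sub>E {0, 1}. r \<epsilon> \<in> sums_of_squares n}"

end

theory Submission
  imports Defs
begin

text \<open>
  Write \<open>u\<^sub>k\<close> for \<open>P\<^sub>k\<close> or \<open>E\<^sub>k\<close>. The classical way to compare \<open>u\<^sub>p\<^sup>q\<close> with \<open>u\<^sub>q\<^sup>p\<close> is to
  chain the log-convexity inequalities \<open>u\<^sub>k\<^sup>2 \<le> u\<^sub>k\<^sub>-\<^sub>1 u\<^sub>k\<^sub>+\<^sub>1\<close> of the power means (or Newton's
  inequalities, which are the reverse for the \<open>E\<^sub>k\<close>) and to cancel common factors. A semiring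
  of polynomials does not allow cancellation, so a stronger input is used: the transfer
  differences \<open>u\<^sub>a u\<^sub>l\<^sub>+\<^sub>1 - u\<^sub>a\<^sub>+\<^sub>1 u\<^sub>l\<close> for all \<open>a < l\<close> belong to the cone, up to sign. Both
  \<open>u\<^sub>p\<^sup>q = u\<^sub>p\<^sup>q u\<^sub>0\<^sup>p\<^sup>-\<^sup>q\<close> (as \<open>u\<^sub>0 = 1\<close>) and \<open>u\<^sub>q\<^sup>p\<close> are products of \<open>p\<close> factors with index sum \<open>p q\<close>, and
  the first becomes the second by moving units from indices above \<open>q\<close> to indices below \<open>q\<close>.
  Each move replaces \<open>u\<^sub>a u\<^sub>l\<^sub>+\<^sub>1\<close> by \<open>u\<^sub>a\<^sub>+\<^sub>1 u\<^sub>l\<close> inside a product of cone elements, so the total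
  change is a sum of products of cone elements (\<open>balancing_chain\<close>, \<open>balancing_power\<close>).

  For power sums, symmetrising the transfer difference over pairs of variables gives terms
  \<open>(x\<^sub>i x\<^sub>j)\<^sup>a (x\<^sub>i - x\<^sub>j) (x\<^sub>i\<^sup>m - x\<^sub>j\<^sup>m)\<close> with \<open>m = l - a\<close>, which are visibly multiples of
  \<open>(x\<^sub>i - x\<^sub>j)\<^sup>2\<close> by cone elements (\<open>power_sum_transfer\<close>). For elementary symmetric means, a
  positive multiple of \<open>u\<^sub>a\<^sub>+\<^sub>1 u\<^sub>l - u\<^sub>a u\<^sub>l\<^sub>+\<^sub>1\<close> equals
  \<open>1/2 \<Sum>\<^sub>i\<^sub>,\<^sub>j (x\<^sub>i - x\<^sub>j)\<^sup>2 (e\<^sub>a e\<^sub>l\<^sub>-\<^sub>1 - e\<^sub>a\<^sub>-\<^sub>1 e\<^sub>l)\<close>, where the \<open>e\<^sub>k\<close> are the unnormalised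
  elementary symmetric polynomials in the variables other than \<open>x\<^sub>i\<close> and \<open>x\<^sub>j\<close>
  (\<open>esym_transfer\<close>). Without normalisation the weak log-concavity needed for the bracket is
  elementary: it has nonnegative coefficients (\<open>esym_log_concave\<close>).
\<close>

section \<open>Semiring cones and balancing chains\<close>

locale semiring_cone =
  fixes T :: "'a::comm_ring_1 set"
  assumes zero_mem: "0 \<in> T"
    and one_mem: "1 \<in> T"
    and add_mem: "f \<in> T \<Longrightarrow> g \<in> T \<Longrightarrow> f + g \<in> T"
    and mult_mem: "f \<in> T \<Longrightarrow> g \<in> T \<Longrightarrow> f * g \<in> T"
begin

lemma sum_mem: "(\<And>i. i \<in> I \<Longrightarrow> f i \<in> T) \<Longrightarrow> sum f I \<in> T"
  by (induction I rule: infinite_finite_induct) (auto simp: zero_mem add_mem)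

lemma prod_mem: "(\<And>i. i \<in> I \<Longrightarrow> f i \<in> T) \<Longrightarrow> prod f I \<in> T"
  by (induction I rule: infinite_finite_induct) (auto simp: one_mem mult_mem)

lemma power_mem: "f \<in> T \<Longrightarrow> f ^ k \<in> T"
  by (induction k) (auto simp: one_mem mult_mem)

text \<open>
  The indices average \<open>q\<close>, so unless all equal \<open>q\<close> there is one above and one below \<open>q\<close>, and a
  unit can be transferred from the former to the latter; the shortfall
  \<open>\<Sum>i\<in>I. q - e i\<close>, with truncated subtraction, drops by one each time. The factor \<open>s\<close> is there to treat log-convex sequences (\<open>s = 1\<close>) and log-concave
  ones (\<open>s = - 1\<close>) together.
\<close>

lemma balancing_chain:
  fixes u :: "nat \<Rightarrow> 'a" and s :: 'a and e :: "'i \<Rightarrow> nat"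
  assumes u_mem: "\<And>k. k \<le> N \<Longrightarrow> u k \<in> T"
    and transfer: "\<And>a l. a < l \<Longrightarrow> Suc l \<le> N \<Longrightarrow> s * (u a * u (Suc l) - u (Suc a) * u l) \<in> T"
    and "finite I" and "\<And>i. i \<in> I \<Longrightarrow> e i \<le> N" and "(\<Sum>i\<in>I. e i) = q * card I"
  shows "s * ((\<Prod>i\<in>I. u (e i)) - u q ^ card I) \<in> T"
  using assms(4,5)
proof (induction "\<Sum>i\<in>I. q - e i" arbitrary: e rule: less_induct)
  case less
  have sum_const: "(\<Sum>i\<in>I. q) = q * card I"
    by simp
  show ?case
  proof (cases "\<forall>i\<in>I. e i = q")
    case True
    then show ?thesis by (simp add: zero_mem)
  next
    case False
    have "\<exists>i\<in>I. e i < q"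
    proof (rule ccontr)
      assume "\<not> ?thesis"
      then have ge: "\<And>i. i \<in> I \<Longrightarrow> q \<le> e i" by force
      with False obtain j where "j \<in> I" "q < e j"
        by (metis le_neq_implies_less)
      then have "(\<Sum>i\<in>I. q) < (\<Sum>i\<in>I. e i)"
        using ge \<open>finite I\<close> by (intro sum_strict_mono_ex1) auto
      then show False using less.prems sum_const by simp
    qed
    then obtain i where i: "i \<in> I" "e i < q" by blast
    have "\<exists>j\<in>I. q < e j"
    proof (rule ccontr)
      assume "\<not> ?thesis"
      then have "(\<Sum>i\<in>I. e i) < (\<Sum>i\<in>I. q)"
        using i \<open>finite I\<close> by (intro sum_strict_mono_ex1) force+
      then show False using less.prems sum_const by simp
    qed
    then obtain j where j: "j \<in> I" "q < e j" by blast
    have "i \<noteq> j" using i j by auto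
    define R where "R = I - {i} - {j}"
    have I: "I = insert i (insert j R)" "i \<notin> R" "j \<notin> R" "finite R"
      using i j \<open>finite I\<close> by (auto simp: R_def)
    obtain l where l: "e j = Suc l" using j by (cases "e j") auto
    define e' where "e' = e(i := Suc (e i), j := l)"
    have R_eq: "(\<Prod>k\<in>R. u (e' k)) = (\<Prod>k\<in>R. u (e k))"
      "(\<Sum>k\<in>R. e' k) = (\<Sum>k\<in>R. e k)" "(\<Sum>k\<in>R. q - e' k) = (\<Sum>k\<in>R. q - e k)"
      using I by (auto simp: e'_def intro!: sum.cong prod.cong)
    have split_sum: "sum f I = f i + (f j + sum f R)" for f :: "'i \<Rightarrow> nat"
      using I \<open>i \<noteq> j\<close> by simp
    have split_prod: "prod f I = f i * (f j * prod f R)" for f :: "'i \<Rightarrow> 'a"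
      using I \<open>i \<noteq> j\<close> by simp
    have e'_ij: "e' i = Suc (e i)" "e' j = l"
      using \<open>i \<noteq> j\<close> by (auto simp: e'_def)
    have "e' k \<le> N" if "k \<in> I" for k
      using less.prems(1)[OF that] less.prems(1)[OF j(1)] i j l \<open>k \<in> I\<close>
      by (auto simp: e'_def)
    moreover have "(\<Sum>k\<in>I. q - e' k) < (\<Sum>k\<in>I. q - e k)"
      unfolding split_sum R_eq e'_ij using i j l by simp
    moreover have "(\<Sum>k\<in>I. e' k) = q * card I"
      unfolding less.prems(2)[symmetric] split_sum R_eq e'_ij using l by simp
    ultimately have IH: "s * ((\<Prod>k\<in>I. u (e' k)) - u q ^ card I) \<in> T"
      using less.hyps by blast
    \<comment> \<open>The change caused by this transfer is the transfer difference times the untouched factors.\<close>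
    have "(\<Prod>k\<in>R. u (e k)) * (s * (u (e i) * u (Suc l) - u (Suc (e i)) * u l)) \<in> T"
      using less.prems(1) i j l I
      by (intro mult_mem prod_mem transfer u_mem) force+
    moreover have "P * (s * (a * b - c * d)) + s * (c * (d * P) - t) = s * (a * (b * P) - t)"
      for P a b c d t :: 'a
      by (simp add: algebra_simps)
    ultimately show ?thesis
      using add_mem[OF _ IH] unfolding split_prod R_eq e'_ij l by metis
  qed
qed

text \<open>
  The chain starts at \<open>q\<close> indices equal to \<open>p\<close> padded with \<open>p - q\<close> zeros, which is the most
  unbalanced distribution of \<open>p q\<close> units over \<open>p\<close> places of capacity \<open>p\<close>.
\<close>

lemma balancing_power:
  fixes u :: "nat \<Rightarrow> 'a" and s :: 'a
  assumes "\<And>k. k \<le> p \<Longrightarrow> u k \<in> T"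
    and "\<And>a l. a < l \<Longrightarrow> Suc l \<le> p \<Longrightarrow> s * (u a * u (Suc l) - u (Suc a) * u l) \<in> T"
    and "u 0 = 1" and "q \<le> p"
  shows "s * (u p ^ q - u q ^ p) \<in> T"
proof -
  define e where "e = (\<lambda>i. if i < q then p else 0)"
  have low: "{..<p} \<inter> {i. i < q} = {..<q}" using \<open>q \<le> p\<close> by auto
  have "(\<Sum>i<p. e i) = q * card {..<p}"
    by (simp add: e_def sum.If_cases low)
  moreover have "(\<Prod>i<p. u (e i)) = u p ^ q"
    by (simp add: e_def if_distrib[of u] \<open>u 0 = 1\<close> prod.If_cases low)
  moreover have "e i \<le> p" for i
    by (simp add: e_def)
  ultimately show ?thesis
    using balancing_chain[of p u s "{..<p}" e q] assms by simp
qed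

text \<open>
  Symmetrised over \<open>i\<close> and \<open>j\<close>, the difference has the terms
  \<open>(x\<^sub>i x\<^sub>j)\<^sup>a (x\<^sub>i - x\<^sub>j) (x\<^sub>i\<^sup>m - x\<^sub>j\<^sup>m)\<close> with \<open>m = l - a\<close>, and the geometric sum turns the last two
  factors into \<open>(x\<^sub>i - x\<^sub>j)\<^sup>2\<close> times a polynomial with nonnegative coefficients. The factor 2
  comes from the symmetrisation.
\<close>

lemma power_sum_transfer:
  fixes x :: "'i \<Rightarrow> 'a"
  assumes x: "\<And>i. i \<in> X \<Longrightarrow> x i \<in> T"
    and sq: "\<And>i j. i \<in> X \<Longrightarrow> j \<in> X \<Longrightarrow> (x i - x j)\<^sup>2 \<in> T"
    and "a < l"
  shows "2 * ((\<Sum>i\<in>X. x i ^ a) * (\<Sum>i\<in>X. x i ^ Suc l)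
    - (\<Sum>i\<in>X. x i ^ Suc a) * (\<Sum>i\<in>X. x i ^ l)) \<in> T"
proof -
  obtain m where m: "l = a + m" using \<open>a < l\<close> less_imp_add_positive by blast
  define F where "F = (\<lambda>i j. x i ^ a * x j ^ Suc l - x i ^ Suc a * x j ^ l)"
  have eq: "F i j + F j i = (x i * x j) ^ a * ((x i - x j)\<^sup>2
      * (\<Sum>t<m. x j ^ (m - Suc t) * x i ^ t))" for i j
  proof -
    have "F i j + F j i = (x i * x j) ^ a * ((x i - x j) * (x i ^ m - x j ^ m))"
      by (simp add: F_def m power_add power_mult_distrib algebra_simps)
    then show ?thesis
      by (simp add: power_diff_sumr2 power2_eq_square mult.assoc)
  qed
  have "(\<Sum>i\<in>X. \<Sum>j\<in>X. F i j + F j i) \<in> T"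
    unfolding eq by (intro sum_mem mult_mem sq power_mem x)
  moreover have "(\<Sum>i\<in>X. x i ^ a) * (\<Sum>i\<in>X. x i ^ Suc l)
    - (\<Sum>i\<in>X. x i ^ Suc a) * (\<Sum>i\<in>X. x i ^ l) = (\<Sum>i\<in>X. \<Sum>j\<in>X. F i j)"
    by (simp add: F_def sum_product sum_subtractf)
  moreover have "(\<Sum>i\<in>X. \<Sum>j\<in>X. F i j + F j i) = 2 * (\<Sum>i\<in>X. \<Sum>j\<in>X. F i j)"
    using sum.swap[of "\<lambda>i j. F j i" X X] by (simp add: sum.distrib)
  ultimately show ?thesis by simp
qed

end

section \<open>Elementary symmetric sums\<close>

text \<open>
  Integer indices make \<open>e\<^sub>k = 0\<close> for negative \<open>k\<close>, so that the recursions below have no boundary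
  cases.
\<close>

definition esym :: "('i \<Rightarrow> 'a::comm_ring_1) \<Rightarrow> 'i set \<Rightarrow> int \<Rightarrow> 'a" where
  "esym x X k = (\<Sum>A | A \<subseteq> X \<and> int (card A) = k. \<Prod>i\<in>A. x i)"

lemma esym_empty:
  fixes x :: "'i \<Rightarrow> 'a::comm_ring_1"
  shows "esym x {} k = (if k = 0 then 1 else 0)"
proof -
  have eq: "{A :: 'i set. A \<subseteq> {} \<and> int (card A) = k} = (if k = 0 then {{}} else {})"
    by auto
  show ?thesis unfolding esym_def eq by simp
qed

lemma esym_insert:
  assumes "finite X" "z \<notin> X"
  shows "esym x (insert z X) k = esym x X k + x z * esym x X (k - 1)"
proof -
  let ?B = "{A. A \<subseteq> X \<and> int (card A) = k}" and ?C = "{A. A \<subseteq> X \<and> int (card A) = k - 1}"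
  have card_insert: "card (insert z A) = Suc (card A)" if "A \<subseteq> X" for A
    using that assms by (metis card_insert_disjoint finite_subset subsetD)
  have split: "{A. A \<subseteq> insert z X \<and> int (card A) = k} = ?B \<union> insert z ` ?C"
  proof (intro equalityI subsetI)
    fix A assume A: "A \<in> {A. A \<subseteq> insert z X \<and> int (card A) = k}"
    show "A \<in> ?B \<union> insert z ` ?C"
    proof (cases "z \<in> A")
      case True
      then have "A = insert z (A - {z})" "A - {z} \<subseteq> X" using A by auto
      moreover from this have "int (card (A - {z})) = k - 1"
        using card_insert[of "A - {z}"] A by auto
      ultimately show ?thesis by blast
    qed (use A in auto)
  qed (auto simp: card_insert)
  have fin: "finite ?B" "finite ?C" using assms by auto
  have inj: "inj_on (insert z) ?C"
    using assms by (intro inj_onI) (metis (no_types, lifting) insert_ident mem_Collect_eq subsetD)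
  have "esym x (insert z X) k = (\<Sum>A\<in>?B. prod x A) + (\<Sum>A\<in>insert z ` ?C. prod x A)"
    unfolding esym_def split using fin assms by (intro sum.union_disjoint) auto
  also have "(\<Sum>A\<in>insert z ` ?C. prod x A) = (\<Sum>A\<in>?C. prod x (insert z A))"
    using inj by (simp add: sum.reindex)
  also have "\<dots> = (\<Sum>A\<in>?C. x z * prod x A)"
    using assms by (intro sum.cong refl prod.insert) (auto dest: finite_subset)
  finally show ?thesis by (simp add: esym_def sum_distrib_left)
qed

lemma insert_remove_other: "z \<notin> X \<Longrightarrow> i \<in> X \<Longrightarrow> insert z X - {i} = insert z (X - {i})"
  by auto

text \<open>Each \<open>k\<close>-subset \<open>A\<close> survives the removal of exactly the \<open>card X - k\<close> elements outside it.\<close>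

lemma sum_esym_remove:
  assumes "finite X"
  shows "(\<Sum>i\<in>X. esym x (X - {i}) k) = of_int (int (card X) - k) * esym x X k"
  using assms
proof (induction X arbitrary: k)
  case empty
  then show ?case by (simp add: esym_empty)
next
  case (insert z X)
  have "(\<Sum>i\<in>X. esym x (insert z X - {i}) k)
      = (\<Sum>i\<in>X. esym x (X - {i}) k + x z * esym x (X - {i}) (k - 1))"
    using insert by (intro sum.cong refl) (simp add: insert_remove_other esym_insert)
  also have "\<dots> = of_int (int (card X) - k) * esym x X k
      + x z * (of_int (int (card X) - (k - 1)) * esym x X (k - 1))"
    by (simp add: sum.distrib sum_distrib_left[symmetric] insert.IH)
  finally show ?case
    using insert by (simp add: esym_insert algebra_simps)
qed

text \<open>Each \<open>k\<close>-subset arises \<open>k\<close> times, once for each choice of a distinguished element \<open>i\<close>.\<close>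

lemma sum_mult_esym_remove:
  assumes "finite X"
  shows "(\<Sum>i\<in>X. x i * esym x (X - {i}) (k - 1)) = of_int k * esym x X k"
  using assms
proof (induction X arbitrary: k)
  case empty
  then show ?case by (simp add: esym_empty)
next
  case (insert z X)
  have "(\<Sum>i\<in>X. x i * esym x (insert z X - {i}) (k - 1))
      = (\<Sum>i\<in>X. x i * esym x (X - {i}) (k - 1) + x z * (x i * esym x (X - {i}) (k - 1 - 1)))"
    using insert
    by (intro sum.cong refl) (simp add: insert_remove_other esym_insert algebra_simps)
  also have "\<dots> = of_int k * esym x X k + x z * (of_int (k - 1) * esym x X (k - 1))"
    by (simp only: sum.distrib sum_distrib_left[symmetric] insert.IH)
  finally show ?case
    using insert by (simp add: esym_insert algebra_simps)
qed

context semiring_cone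
begin

text \<open>
  Let \<open>D a b\<close> be the difference in question. Adding a variable \<open>z\<close> replaces \<open>D a b\<close> by
  \<open>D a b + z (D a (b - 1) + D (a - 1) b) + z\<^sup>2 D (a - 1) (b - 1)\<close>, where the two cross terms
  regroup because \<open>e\<^sub>a\<^sub>-\<^sub>1 e\<^sub>b\<close> cancels. The range \<open>a \<le> b + 1\<close>, whose extreme case is trivially zero,
  rather than \<open>a \<le> b\<close> is what keeps \<open>D a (b - 1)\<close> covered when \<open>a = b\<close>.
\<close>

lemma esym_log_concave:
  assumes "finite X" and "\<And>i. i \<in> X \<Longrightarrow> x i \<in> T" and "a \<le> b + 1"
  shows "esym x X a * esym x X b - esym x X (a - 1) * esym x X (b + 1) \<in> T"
  using assms
proof (induction X arbitrary: a b)
  case empty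
  then show ?case by (auto simp: esym_empty zero_mem one_mem)
next
  case (insert z X)
  define D where "D = (\<lambda>a b. esym x X a * esym x X b - esym x X (a - 1) * esym x X (b + 1))"
  have D_mem: "D a' b' \<in> T" if "a' \<le> b' + 1" for a' b'
    unfolding D_def using insert.prems(1) that by (intro insert.IH) auto
  show ?case
  proof (cases "a = b + 1")
    case True
    then show ?thesis by (simp add: zero_mem mult.commute)
  next
    case False
    then have "D a b \<in> T" "D a (b - 1) \<in> T" "D (a - 1) b \<in> T" "D (a - 1) (b - 1) \<in> T"
      using insert.prems(2) by (auto intro!: D_mem)
    then have "D a b + x z * (D a (b - 1) + D (a - 1) b) + x z * x z * D (a - 1) (b - 1) \<in> T"
      using insert.prems by (intro add_mem mult_mem) auto
    moreover have "a - 1 - 1 = a - 2" "b - 1 + 1 = b" "b + 1 - 1 = b" by auto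
    ultimately show ?thesis
      using insert.hyps by (simp add: D_def esym_insert algebra_simps)
  qed
qed

text \<open>
  By the two removal identities the scaled difference is
  \<open>\<Sum>\<^sub>i\<^sub>,\<^sub>j (x\<^sub>i - x\<^sub>j) e\<^sub>a(X - i) e\<^sub>l(X - j)\<close>. Adding the terms for \<open>(i, j)\<close> and \<open>(j, i)\<close>
  antisymmetrises the product of the two sums; expanding each of them in the one variable that it
  still contains among \<open>x\<^sub>i, x\<^sub>j\<close> gives another \<open>x\<^sub>i - x\<^sub>j\<close> times a difference covered by
  \<open>esym_log_concave\<close>. The scaling is the one that turns the \<open>e\<^sub>k\<close> into means.
\<close>

lemma esym_transfer:
  fixes x :: "'i \<Rightarrow> 'a"
  assumes X: "finite X" and x: "\<And>i. i \<in> X \<Longrightarrow> x i \<in> T"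
    and sq: "\<And>i j. i \<in> X \<Longrightarrow> j \<in> X \<Longrightarrow> (x i - x j)\<^sup>2 \<in> T"
    and "a < l"
  shows "2 * (of_int (a + 1) * of_int (int (card X) - l) * (esym x X (a + 1) * esym x X l)
    - of_int (int (card X) - a) * of_int (l + 1) * (esym x X a * esym x X (l + 1))) \<in> T"
    (is "2 * ?Z \<in> T")
proof -
  define F where "F = (\<lambda>i j. (x i - x j) * (esym x (X - {i}) a * esym x (X - {j}) l))"
  have "?Z = (\<Sum>i\<in>X. x i * esym x (X - {i}) a) * (\<Sum>j\<in>X. esym x (X - {j}) l)
      - (\<Sum>i\<in>X. esym x (X - {i}) a) * (\<Sum>j\<in>X. x j * esym x (X - {j}) l)"
    using sum_mult_esym_remove[OF X, of x "a + 1"] sum_mult_esym_remove[OF X, of x "l + 1"]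
    by (simp add: sum_esym_remove[OF X] algebra_simps)
  also have "\<dots> = (\<Sum>i\<in>X. \<Sum>j\<in>X. F i j)"
    unfolding sum_product sum_subtractf[symmetric] F_def
    by (intro sum.cong refl) (simp add: algebra_simps)
  finally have Z: "?Z = (\<Sum>i\<in>X. \<Sum>j\<in>X. F i j)" .
  have "F i j + F j i \<in> T" if ij: "i \<in> X" "j \<in> X" for i j
  proof (cases "i = j")
    case True
    then show ?thesis by (simp add: F_def zero_mem)
  next
    case False
    define Y where "Y = X - {i} - {j}"
    have Y: "finite Y" "i \<notin> Y" "j \<notin> Y" "X - {i} = insert j Y" "X - {j} = insert i Y"
      using ij X False by (auto simp: Y_def)
    have "F i j + F j i = (x i - x j)\<^sup>2
        * (esym x Y a * esym x Y (l - 1) - esym x Y (a - 1) * esym x Y (l - 1 + 1))"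
      using Y by (simp add: F_def esym_insert power2_eq_square algebra_simps)
    moreover have "esym x Y a * esym x Y (l - 1) - esym x Y (a - 1) * esym x Y (l - 1 + 1) \<in> T"
      using \<open>a < l\<close> x by (intro esym_log_concave Y) (auto simp: Y_def)
    ultimately show ?thesis
      using ij by (simp add: sq mult_mem)
  qed
  then have "(\<Sum>i\<in>X. \<Sum>j\<in>X. F i j + F j i) \<in> T"
    by (intro sum_mem)
  also have "(\<Sum>i\<in>X. \<Sum>j\<in>X. F i j + F j i) = 2 * (\<Sum>i\<in>X. \<Sum>j\<in>X. F i j)"
    using sum.swap[of "\<lambda>i j. F j i" X X] by (simp add: sum.distrib)
  finally show ?thesis unfolding Z .
qed

end

section \<open>The semiring generated by variables and squares\<close>

lemma Const_mult: "Const (a * b) = Const a * Const b"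
  by (simp add: Const_def mult_single)

lemma Const_add: "Const (a + b) = Const a + Const b"
  by (simp add: Const_def single_add)

lemma Const_0: "Const 0 = 0" and Const_1: "Const 1 = 1"
  by (simp_all add: Const_def)

lemma Const_of_nat: "Const (real m) = of_nat m"
  by (induction m) (simp_all add: Const_0 Const_1 Const_add)

lemma polys_mult: "f \<in> polys n \<Longrightarrow> g \<in> polys n \<Longrightarrow> f * g \<in> polys n"
proof (unfold polys_def, safe)
  fix m i
  assume f: "\<forall>m\<in>Poly_Mapping.keys f. Poly_Mapping.keys m \<subseteq> {1..n}"
    and g: "\<forall>m\<in>Poly_Mapping.keys g. Poly_Mapping.keys m \<subseteq> {1..n}"
    and "m \<in> Poly_Mapping.keys (f * g)" and i: "i \<in> Poly_Mapping.keys m"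
  then obtain a b where "a \<in> Poly_Mapping.keys f" "b \<in> Poly_Mapping.keys g" "m = a + b"
    using keys_mult by blast
  then show "i \<in> {1..n}"
    using f g i Poly_Mapping.keys_add[of a b] by blast
qed

lemma polys_diff: "f \<in> polys n \<Longrightarrow> g \<in> polys n \<Longrightarrow> f - g \<in> polys n"
  unfolding polys_def using keys_diff[of f g] by blast

lemma Const_polys: "Const c \<in> polys n"
  by (auto simp: Const_def polys_def split: if_splits)

lemma Var_polys: "i \<in> {1..n} \<Longrightarrow> Var i \<in> polys n"
  by (auto simp: Var_def polys_def split: if_splits)

lemma zero_sos: "0 \<in> sums_of_squares n"
  unfolding sums_of_squares_def by (auto intro!: exI[of _ 0])

lemma square_sos: "g \<in> polys n \<Longrightarrow> g\<^sup>2 \<in> sums_of_squares n"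
  unfolding sums_of_squares_def by (auto intro!: exI[of _ 1] exI[of _ "\<lambda>_. g"])

lemma square_mult_sos:
  assumes "h \<in> polys n" "f \<in> sums_of_squares n"
  shows "h\<^sup>2 * f \<in> sums_of_squares n"
proof -
  from assms(2) obtain m g where g: "f = (\<Sum>i<m. (g i)\<^sup>2)" "\<forall>i<(m::nat). g i \<in> polys n"
    unfolding sums_of_squares_def by blast
  have "h\<^sup>2 * f = (\<Sum>i<m. (h * g i)\<^sup>2)"
    by (simp add: g sum_distrib_left power_mult_distrib)
  then show ?thesis
    unfolding sums_of_squares_def using g(2) polys_mult[OF assms(1)]
    by (auto intro!: exI[of _ m] exI[of _ "\<lambda>i. h * g i"])
qed

lemma add_sos:
  assumes "f \<in> sums_of_squares n" "f' \<in> sums_of_squares n"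
  shows "f + f' \<in> sums_of_squares n"
proof -
  from assms(1) obtain m g where g: "f = (\<Sum>i<m. (g i)\<^sup>2)" "\<forall>i<(m::nat). g i \<in> polys n"
    unfolding sums_of_squares_def by blast
  from assms(2) obtain m' g' where g': "f' = (\<Sum>i<m'. (g' i)\<^sup>2)" "\<forall>i<(m'::nat). g' i \<in> polys n"
    unfolding sums_of_squares_def by blast
  define G where "G = (\<lambda>i. if i < m then g i else g' (i - m))"
  have "(\<Sum>i<m + m'. (G i)\<^sup>2) = f + f'"
    unfolding g(1) g'(1) by (induction m') (simp_all add: G_def add.assoc)
  moreover have "\<forall>i<m + m'. G i \<in> polys n"
    using g g' by (auto simp: G_def)
  ultimately show ?thesis
    unfolding sums_of_squares_def mem_Collect_eq by metis
qed

abbreviation cube :: "nat \<Rightarrow> (nat \<Rightarrow> nat) set" where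
  "cube n \<equiv> {1..n} \<rightarrow>\<^sub>E {0, 1 :: nat}"

abbreviation mon :: "nat \<Rightarrow> (nat \<Rightarrow> nat) \<Rightarrow> mpoly" where
  "mon n \<epsilon> \<equiv> \<Prod>j = 1..n. Var j ^ \<epsilon> j"

lemma finite_cube: "finite (cube n)"
  by (intro finite_PiE) auto

lemma S_coneI:
  "(\<And>\<epsilon>. \<epsilon> \<in> cube n \<Longrightarrow> r \<epsilon> \<in> sums_of_squares n) \<Longrightarrow> (\<Sum>\<epsilon>\<in>cube n. r \<epsilon> * mon n \<epsilon>) \<in> S_cone n"
  unfolding S_cone_def by blast

lemma S_coneE:
  assumes "f \<in> S_cone n"
  obtains r where "\<And>\<epsilon>. \<epsilon> \<in> cube n \<Longrightarrow> r \<epsilon> \<in> sums_of_squares n"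
    "f = (\<Sum>\<epsilon>\<in>cube n. r \<epsilon> * mon n \<epsilon>)"
  using assms unfolding S_cone_def by blast

lemma zero_S_cone: "0 \<in> S_cone n"
  using S_coneI[of n "\<lambda>_. 0"] zero_sos by simp

lemma add_S_cone:
  assumes "f \<in> S_cone n" "g \<in> S_cone n"
  shows "f + g \<in> S_cone n"
proof -
  obtain r where r: "\<And>\<epsilon>. \<epsilon> \<in> cube n \<Longrightarrow> r \<epsilon> \<in> sums_of_squares n"
    "f = (\<Sum>\<epsilon>\<in>cube n. r \<epsilon> * mon n \<epsilon>)" using S_coneE[OF assms(1)] by blast
  obtain s where s: "\<And>\<epsilon>. \<epsilon> \<in> cube n \<Longrightarrow> s \<epsilon> \<in> sums_of_squares n"
    "g = (\<Sum>\<epsilon>\<in>cube n. s \<epsilon> * mon n \<epsilon>)" using S_coneE[OF assms(2)] by blast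
  have "f + g = (\<Sum>\<epsilon>\<in>cube n. (r \<epsilon> + s \<epsilon>) * mon n \<epsilon>)"
    by (simp add: r(2) s(2) sum.distrib distrib_right)
  then show ?thesis
    using S_coneI[of n "\<lambda>\<epsilon>. r \<epsilon> + s \<epsilon>"] add_sos r(1) s(1) by simp
qed

lemma sum_S_cone: "(\<And>i. i \<in> I \<Longrightarrow> f i \<in> S_cone n) \<Longrightarrow> sum f I \<in> S_cone n"
  by (induction I rule: infinite_finite_induct) (auto simp: zero_S_cone add_S_cone)

lemma square_mult_S_cone:
  assumes "h \<in> polys n" "f \<in> S_cone n"
  shows "h\<^sup>2 * f \<in> S_cone n"
proof -
  obtain r where r: "\<And>\<epsilon>. \<epsilon> \<in> cube n \<Longrightarrow> r \<epsilon> \<in> sums_of_squares n"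
    "f = (\<Sum>\<epsilon>\<in>cube n. r \<epsilon> * mon n \<epsilon>)" using S_coneE[OF assms(2)] by blast
  have "h\<^sup>2 * f = (\<Sum>\<epsilon>\<in>cube n. (h\<^sup>2 * r \<epsilon>) * mon n \<epsilon>)"
    by (simp add: r(2) sum_distrib_left mult.assoc)
  then show ?thesis
    using S_coneI[of n "\<lambda>\<epsilon>. h\<^sup>2 * r \<epsilon>"] square_mult_sos[OF assms(1)] r(1) by simp
qed

lemma sos_mult_mon_S_cone:
  assumes "r \<in> sums_of_squares n" "\<epsilon> \<in> cube n"
  shows "r * mon n \<epsilon> \<in> S_cone n"
proof -
  have "(\<Sum>\<delta>\<in>cube n. (if \<delta> = \<epsilon> then r else 0) * mon n \<delta>)
      = (\<Sum>\<delta>\<in>cube n. if \<delta> = \<epsilon> then r * mon n \<epsilon> else 0)"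
    by (intro sum.cong) auto
  also have "\<dots> = r * mon n \<epsilon>"
    using assms(2) finite_cube by (simp add: sum.delta)
  finally show ?thesis
    using S_coneI[of n "\<lambda>\<delta>. if \<delta> = \<epsilon> then r else 0"] assms(1) zero_sos by simp
qed

text \<open>
  If \<open>x\<^sub>i\<close> already divides the squarefree monomial, the resulting \<open>x\<^sub>i\<^sup>2\<close> is absorbed as a square.
\<close>

lemma Var_mult_S_cone:
  assumes i: "i \<in> {1..n}" and "f \<in> S_cone n"
  shows "Var i * f \<in> S_cone n"
proof -
  obtain r where r: "\<And>\<epsilon>. \<epsilon> \<in> cube n \<Longrightarrow> r \<epsilon> \<in> sums_of_squares n"
    "f = (\<Sum>\<epsilon>\<in>cube n. r \<epsilon> * mon n \<epsilon>)" using S_coneE[OF assms(2)] by blast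
  have "Var i * (r \<epsilon> * mon n \<epsilon>) \<in> S_cone n" if \<epsilon>: "\<epsilon> \<in> cube n" for \<epsilon>
  proof -
    have mon_upd: "mon n (\<epsilon>(i := k)) = Var i ^ k * (\<Prod>j\<in>{1..n} - {i}. Var j ^ \<epsilon> j)" for k
      using i by (subst prod.remove[of _ i]) (auto intro!: arg_cong2[of _ _ _ _ "(*)"] prod.cong)
    have mon: "mon n \<epsilon> = Var i ^ \<epsilon> i * (\<Prod>j\<in>{1..n} - {i}. Var j ^ \<epsilon> j)"
      using mon_upd[of "\<epsilon> i"] by simp
    have upd: "\<epsilon>(i := k) \<in> cube n" if "k \<in> {0, 1}" for k
      using \<epsilon> i that by (auto simp: PiE_iff extensional_def)
    have "\<epsilon> i \<in> {0, 1}" using \<epsilon> i by (auto simp: PiE_iff)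
    then consider "\<epsilon> i = 0" | "\<epsilon> i = 1" by auto
    then show ?thesis
    proof cases
      case 1
      then have eq: "Var i * (r \<epsilon> * mon n \<epsilon>) = r \<epsilon> * mon n (\<epsilon>(i := 1))"
        unfolding mon mon_upd by (simp add: algebra_simps)
      show ?thesis
        unfolding eq by (intro sos_mult_mon_S_cone r(1) \<epsilon> upd) simp
    next
      case 2
      then have eq: "Var i * (r \<epsilon> * mon n \<epsilon>) = (Var i)\<^sup>2 * (r \<epsilon> * mon n (\<epsilon>(i := 0)))"
        unfolding mon mon_upd by (simp add: power2_eq_square algebra_simps)
      show ?thesis
        unfolding eq by (intro square_mult_S_cone sos_mult_mon_S_cone r(1) \<epsilon> upd Var_polys i) simp
    qed
  qed
  then show ?thesis
    unfolding r(2) sum_distrib_left by (rule sum_S_cone)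
qed

text \<open>
  A cone element is a sum of products of squares and variables, and multiplication by each such
  factor preserves the cone. Thus the cone is the semiring generated by variables and squares.
\<close>

lemma mult_S_cone:
  assumes "f \<in> S_cone n" and g: "g \<in> S_cone n"
  shows "f * g \<in> S_cone n"
proof -
  obtain r where r: "\<And>\<epsilon>. \<epsilon> \<in> cube n \<Longrightarrow> r \<epsilon> \<in> sums_of_squares n"
    "f = (\<Sum>\<epsilon>\<in>cube n. r \<epsilon> * mon n \<epsilon>)" using S_coneE[OF assms(1)] by blast
  have Var_power: "Var j ^ k * h \<in> S_cone n" if "j \<in> {1..n}" "h \<in> S_cone n" for j k h
    using that by (induction k) (auto simp: mult.assoc Var_mult_S_cone)
  have mon: "(\<Prod>j\<in>J. Var j ^ \<epsilon> j) * h \<in> S_cone n" if "J \<subseteq> {1..n}" "h \<in> S_cone n" for J \<epsilon> h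
  proof -
    have "finite J" using that finite_subset by blast
    then show ?thesis
      using that by (induction J) (auto simp: mult.assoc Var_power)
  qed
  have sos: "s * h \<in> S_cone n" if s: "s \<in> sums_of_squares n" and h: "h \<in> S_cone n" for s h
  proof -
    from s obtain m g where "s = (\<Sum>i<m. (g i)\<^sup>2)" "\<forall>i<(m::nat). g i \<in> polys n"
      unfolding sums_of_squares_def by blast
    then show ?thesis
      using h by (auto simp: sum_distrib_right intro!: sum_S_cone square_mult_S_cone)
  qed
  show ?thesis
    unfolding r(2) sum_distrib_right mult.assoc
    using r(1) g by (intro sum_S_cone sos mon) auto
qed

lemma one_S_cone: "1 \<in> S_cone n"
proof -
  \<comment> \<open>The zero exponent vector; \<open>undefined\<close> makes it extensional.\<close>
  define \<epsilon>\<^sub>0 where "\<epsilon>\<^sub>0 = (\<lambda>j. if j \<in> {1..n} then 0 else undefined :: nat)"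
  have "\<epsilon>\<^sub>0 \<in> cube n" by (auto simp: \<epsilon>\<^sub>0_def)
  moreover have "mon n \<epsilon>\<^sub>0 = 1" by (simp add: \<epsilon>\<^sub>0_def)
  moreover have "1 \<in> sums_of_squares n"
    using square_sos[OF Const_polys[of 1]] by (simp add: Const_1)
  ultimately show ?thesis
    using sos_mult_mon_S_cone[of 1 n \<epsilon>\<^sub>0] by (metis mult_1_right)
qed

lemma semiring_cone_S_cone: "semiring_cone (S_cone n)"
  by (intro semiring_cone.intro zero_S_cone one_S_cone add_S_cone mult_S_cone)

interpretation S_cone: semiring_cone "S_cone n" for n
  by (rule semiring_cone_S_cone)

lemma square_S_cone: "g \<in> polys n \<Longrightarrow> g\<^sup>2 \<in> S_cone n"
  using square_mult_S_cone[OF _ one_S_cone] by simp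

lemma Var_S_cone: "i \<in> {1..n} \<Longrightarrow> Var i \<in> S_cone n"
  using Var_mult_S_cone[OF _ one_S_cone] by simp

lemma Var_diff_square_S_cone: "i \<in> {1..n} \<Longrightarrow> j \<in> {1..n} \<Longrightarrow> (Var i - Var j)\<^sup>2 \<in> S_cone n"
  by (intro square_S_cone polys_diff Var_polys)

lemma Const_S_cone:
  assumes "c \<ge> 0"
  shows "Const c \<in> S_cone n"
proof -
  have "Const c = (Const (sqrt c))\<^sup>2"
    using assms by (simp add: power2_eq_square flip: Const_mult)
  then show ?thesis
    using square_S_cone[OF Const_polys] by simp
qed

section \<open>Power means and elementary symmetric means\<close>

lemma power_mean_poly_0: "n \<ge> 1 \<Longrightarrow> power_mean_poly n 0 = 1"
  by (simp add: power_mean_poly_def Const_1 flip: Const_of_nat Const_mult)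

lemma elem_mean_poly_0: "elem_mean_poly n 0 = 1"
proof -
  have "{A. A \<subseteq> {1..n} \<and> card A = 0} = {{}}"
    by (auto dest: finite_subset)
  then show ?thesis by (simp add: elem_mean_poly_def Const_1)
qed

lemma power_mean_poly_S_cone: "power_mean_poly n k \<in> S_cone n"
  unfolding power_mean_poly_def
  by (intro S_cone.mult_mem S_cone.sum_mem S_cone.power_mem Const_S_cone Var_S_cone) auto

lemma elem_mean_poly_S_cone: "elem_mean_poly n k \<in> S_cone n"
  unfolding elem_mean_poly_def
  by (intro S_cone.mult_mem S_cone.sum_mem S_cone.prod_mem Const_S_cone Var_S_cone) auto

lemma elem_mean_poly_eq_esym:
  "elem_mean_poly n k = Const (1 / real (n choose k)) * esym Var {1..n} (int k)"
  by (simp add: elem_mean_poly_def esym_def)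

lemma Const_eq_half_mult_2: "Const c = Const (c / 2) * 2"
proof -
  have "Const c = Const (c / 2) * Const (real 2)"
    by (simp flip: Const_mult)
  then show ?thesis unfolding Const_of_nat by simp
qed

lemma power_mean_poly_transfer:
  assumes "a < l"
  shows "power_mean_poly n a * power_mean_poly n (Suc l)
    - power_mean_poly n (Suc a) * power_mean_poly n l \<in> S_cone n"
proof -
  let ?p = "\<lambda>k. \<Sum>i=1..n. Var i ^ k" and ?c = "1 / real n * (1 / real n)"
  have "Const (?c / 2) * (2 * (?p a * ?p (Suc l) - ?p (Suc a) * ?p l)) \<in> S_cone n"
    using assms
    by (intro S_cone.mult_mem S_cone.power_sum_transfer Const_S_cone Var_S_cone
        Var_diff_square_S_cone) auto
  also have "Const (?c / 2) * (2 * (?p a * ?p (Suc l) - ?p (Suc a) * ?p l))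
      = Const ?c * (?p a * ?p (Suc l) - ?p (Suc a) * ?p l)"
    by (simp only: Const_eq_half_mult_2[of ?c] mult.assoc)
  also have "\<dots> = power_mean_poly n a * power_mean_poly n (Suc l)
      - power_mean_poly n (Suc a) * power_mean_poly n l"
    unfolding power_mean_poly_def Const_mult by (simp only: algebra_simps)
  finally show ?thesis .
qed

text \<open>
  The absorption identity \<open>(n choose k) (n - k) = (k + 1) (n choose (k + 1))\<close> matches the scaling
  factors of \<open>esym_transfer\<close> with the four binomial coefficients in the means, so that a single
  constant \<open>c\<close> normalises both products.
\<close>

lemma elem_mean_poly_transfer:
  assumes "a < l" "Suc l \<le> n"
  shows "elem_mean_poly n (Suc a) * elem_mean_poly n l
    - elem_mean_poly n a * elem_mean_poly n (Suc l) \<in> S_cone n"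
proof -
  let ?e = "\<lambda>k. esym Var {1..n} (int k)" and ?b = "\<lambda>k. real (n choose k)"
  define c where "c = 1 / (?b a * ?b l * real (n - a) * real (n - l))"
  define Z where "Z = of_nat (Suc a * (n - l)) * (?e (Suc a) * ?e l)
    - of_nat ((n - a) * Suc l) * (?e a * ?e (Suc l))"
  have "2 * Z \<in> S_cone n"
  proof -
    have int_eqs: "int a + 1 = int (Suc a)" "int l + 1 = int (Suc l)"
      "int (card {1..n}) - int a = int (n - a)" "int (card {1..n}) - int l = int (n - l)"
      using assms by auto
    show ?thesis
      using S_cone.esym_transfer[of "{1..n}" Var n "int a" "int l"] assms
        Var_S_cone Var_diff_square_S_cone
      unfolding Z_def of_nat_mult int_eqs of_int_of_nat_eq by auto
  qed
  then have "Const (c / 2) * (2 * Z) \<in> S_cone n"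
    by (intro S_cone.mult_mem[OF Const_S_cone]) (auto simp: c_def)
  then have cZ: "Const c * Z \<in> S_cone n"
    by (simp only: Const_eq_half_mult_2[of c] mult.assoc)
  have absorb: "?b k * real (n - k) = real (Suc k) * ?b (Suc k)" for k
    using binomial_absorb_comp[of n k] binomial_absorption[of k n]
    by (metis mult.commute of_nat_mult)
  have cancel: "1 / (u * v * w * y) * (u * y) = 1 / v * (1 / w)" if "u \<noteq> 0" "y \<noteq> 0" for u v w y :: real
    using that by simp
  have "c = 1 / (real (Suc a) * ?b (Suc a) * ?b l * real (n - l))"
    unfolding c_def absorb[symmetric] by (simp add: mult_ac)
  then have "c * real (Suc a * (n - l)) = 1 / ?b (Suc a) * (1 / ?b l)"
    using assms unfolding of_nat_mult by (simp only:) (rule cancel, auto)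
  moreover have "c = 1 / (real (n - a) * ?b a * ?b (Suc l) * real (Suc l))"
  proof -
    have "?b a * ?b l * real (n - a) * real (n - l) = ?b a * real (n - a) * (?b l * real (n - l))"
      by (simp only: mult_ac)
    then show ?thesis
      unfolding c_def absorb[of l] by (simp only: mult_ac)
  qed
  then have "c * real ((n - a) * Suc l) = 1 / ?b a * (1 / ?b (Suc l))"
    using assms unfolding of_nat_mult by (simp only:) (rule cancel, auto)
  moreover have "Const c * Z = Const (c * real (Suc a * (n - l))) * (?e (Suc a) * ?e l)
      - Const (c * real ((n - a) * Suc l)) * (?e a * ?e (Suc l))"
    unfolding Z_def Const_mult Const_of_nat by (simp only: algebra_simps)
  ultimately have "Const c * Z = elem_mean_poly n (Suc a) * elem_mean_poly n l
      - elem_mean_poly n a * elem_mean_poly n (Suc l)"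
    by (simp only: elem_mean_poly_eq_esym Const_mult) (simp only: mult_ac)
  with cZ show ?thesis by simp
qed

theorem theorem4:
  fixes n p q :: nat
  assumes "n \<ge> 1" and "p \<ge> q" and "q \<ge> 1"
  shows "power_mean_poly n p ^ q - power_mean_poly n q ^ p \<in> S_cone n \<and>
    (p \<le> n \<longrightarrow> elem_mean_poly n q ^ p - elem_mean_poly n p ^ q \<in> S_cone n)"
proof (intro conjI impI)
  show "power_mean_poly n p ^ q - power_mean_poly n q ^ p \<in> S_cone n"
    using S_cone.balancing_power[of p "power_mean_poly n" n 1 q] assms
    by (simp add: power_mean_poly_S_cone power_mean_poly_transfer power_mean_poly_0)
next
  assume "p \<le> n"
  then show "elem_mean_poly n q ^ p - elem_mean_poly n p ^ q \<in> S_cone n"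
    using S_cone.balancing_power[of p "elem_mean_poly n" n "- 1" q] assms
    by (simp add: elem_mean_poly_S_cone elem_mean_poly_transfer elem_mean_poly_0)
qed

end
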